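(* Let $I,J$ be disjoint finite sets, and let $T$ be a symmetrized tropical matrix with row index set $I^1\cup I^2$ and column index set $I\cup J$. Then $$\operatorname{tropical\ rank}(T)=\operatorname{tropical\ rank}(\Sigma(T))+|I|.$$
   Context: Supertropical structure: $\mathbb{S}=\mathbb{R}^{\tau}\cup\mathbb{R}^{\gamma}\cup\{\infty\}$ with tangible elements $a^\tau$ and ghost elements $a^\gamma$ ($a\in\mathbb{R}$); for $a>b$: $\infty\oplus s=s$, $\infty\odot s=\infty$, $b^j\oplus a^i=b^j$, $b^i\oplus b^j=b^\gamma$, $a^i\odot b^j=(a+b)^\alpha$ with $\alpha=\tau$ iff $i=j=\tau$. The permanent of an $m\times m$ supertropical matrix $A$ is $\bigoplus_{\sigma\in S_m}A(1|\sigma_1)\odot\cdots\odot A(m|\sigma_m)$; $A$ is tropically non-singular if its permanent is tangible, and the tropical rank of a supertropical matrix is the largest size of a tropically non-singular square submatrix. A tropical matrix (entries in $\overline{\mathbb{R}}=\mathbb{R}\cup\{\infty\}$) is regarded as supertropical by replacing each real $a$ by $a^\tau$. $I^1,I^2$ are two disjoint copies of $I$ (also disjoint from $I\cup J$), with $i^1,i^2$ the copies of $i\in I$. A tropical matrix $T$ with rows $I^1\cup I^2$ and columns $I\cup J$ is symmetrized if $T(i^1|i)=T(i^2|i)=0$ and $T(i^1|\hat\iota)=T(i^2|\hat\iota)=\infty$ for all $i\in I$, $\hat\iota\in I\setminus\{i\}$. Then $\Sigma(T)\in\mathbb{S}^{I\times J}$ is defined by $\Sigma(T)(i|j)=T(i^1|j)^\tau\oplus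 T(i^2|j)^\tau$ (with $\infty^\tau$ meaning $\infty$). *)

theory Defs
  imports Complex_Main "HOL-Library.FuncSet"
begin

datatype trop = Fin real | TInfty

datatype supertrop = Tangible real | Ghost real | Infty

(* Min-plus convention: the smaller real dominates, so Infty is the additive neutral element and
   Tangible 0 is the multiplicative one. *)

instantiation supertrop :: comm_semiring_1
begin

definition zero_supertrop :: supertrop where
  "0 = Infty"

definition one_supertrop :: supertrop where
  "1 = Tangible 0"

fun plus_supertrop :: "supertrop \<Rightarrow> supertrop \<Rightarrow> supertrop" where
  "Infty + s = s"
| "s + Infty = s"
| "Tangible a + Tangible b = (if a < b then Tangible a else if b < a then Tangible b else Ghost a)"
| "Tangible a + Ghost b = (if a < b then Tangible a else if b < a then Ghost b else Ghost a)"
| "Ghost a + Tangible b = (if a < b then Ghost a else if b < a then Tangible b else Ghost a)"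
| "Ghost a + Ghost b = (if a < b then Ghost a else if b < a then Ghost b else Ghost a)"

fun times_supertrop :: "supertrop \<Rightarrow> supertrop \<Rightarrow> supertrop" where
  "Infty * s = Infty"
| "s * Infty = Infty"
| "Tangible a * Tangible b = Tangible (a + b)"
| "Tangible a * Ghost b = Ghost (a + b)"
| "Ghost a * Tangible b = Ghost (a + b)"
| "Ghost a * Ghost b = Ghost (a + b)"

instance
proof
  fix a b c :: supertrop
  show "a + b + c = a + (b + c)"
    by (cases a; cases b; cases c) auto
  show "a + b = b + a"
    by (cases a; cases b) auto
  show "0 + a = a"
    by (simp add: zero_supertrop_def)
  show "a * b * c = a * (b * c)"
    by (cases a; cases b; cases c) auto
  show "a * b = b * a"
    by (cases a; cases b) auto
  show "1 * a = a"
    by (cases a) (auto simp: one_supertrop_def)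
  show "(a + b) * c = a * c + b * c"
    by (cases a; cases b; cases c) auto
  show "0 * a = 0" and "a * 0 = 0"
    by (cases a; simp add: zero_supertrop_def)+
  show "(0::supertrop) \<noteq> 1"
    by (simp add: zero_supertrop_def one_supertrop_def)
qed

end

definition tangible :: "supertrop \<Rightarrow> bool" where
  "tangible s \<longleftrightarrow> (\<exists>a. s = Tangible a)"

fun supertrop_of_trop :: "trop \<Rightarrow> supertrop" where
  "supertrop_of_trop (Fin a) = Tangible a"
| "supertrop_of_trop TInfty = Infty"

(* Matrices are functions together with explicit row and column index sets. Numbering both R and C
   by {1..m} turns the bijections R -> C into the permutations of {1..m}, and the sum does not
   depend on the numberings. *)
definition permanent ::
  "'r set \<Rightarrow> 'c set \<Rightarrow> ('r \<Rightarrow> 'c \<Rightarrow> supertrop) \<Rightarrow> supertrop" where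
  "permanent R C A = (\<Sum>\<sigma>\<in>{\<sigma> \<in> R \<rightarrow>\<^sub>E C. bij_betw \<sigma> R C}. \<Prod>r\<in>R. A r (\<sigma> r))"

definition trop_nonsingular ::
  "'r set \<Rightarrow> 'c set \<Rightarrow> ('r \<Rightarrow> 'c \<Rightarrow> supertrop) \<Rightarrow> bool" where
  "trop_nonsingular R C A \<longleftrightarrow> tangible (permanent R C A)"

(* Meaningful for finite Rows and Cols. The empty submatrix has permanent 1 = Tangible 0, so it is
   non-singular and the set below is never empty. *)
definition tropical_rank ::
  "'r set \<Rightarrow> 'c set \<Rightarrow> ('r \<Rightarrow> 'c \<Rightarrow> supertrop) \<Rightarrow> nat" where
  "tropical_rank Rows Cols A =
     Max {m. \<exists>R C. R \<subseteq> Rows \<and> C \<subseteq> Cols \<and> card R = m \<and> card C = m \<and> trop_nonsingular R C A}"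

definition supertrop_matrix :: "('r \<Rightarrow> 'c \<Rightarrow> trop) \<Rightarrow> 'r \<Rightarrow> 'c \<Rightarrow> supertrop" where
  "supertrop_matrix T = (\<lambda>r c. supertrop_of_trop (T r c))"

(* The two disjoint copies of i in I are Inl i and Inr i; the row set is I <+> I. *)
definition symmetrized :: "'a set \<Rightarrow> ('a + 'a \<Rightarrow> 'a \<Rightarrow> trop) \<Rightarrow> bool" where
  "symmetrized I T \<longleftrightarrow>
     (\<forall>i\<in>I. T (Inl i) i = Fin 0 \<and> T (Inr i) i = Fin 0 \<and>
       (\<forall>k\<in>I - {i}. T (Inl i) k = TInfty \<and> T (Inr i) k = TInfty))"

definition Sigma_matrix :: "('a + 'a \<Rightarrow> 'a \<Rightarrow> trop) \<Rightarrow> 'a \<Rightarrow> 'a \<Rightarrow> supertrop" where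
  "Sigma_matrix T = (\<lambda>i j. supertrop_of_trop (T (Inl i) j) + supertrop_of_trop (T (Inr i) j))"

end

theory Submission
  imports Defs
begin

text \<open>
  If a set \<open>R\<close> of rows of \<open>T\<close> is combined with the columns \<open>base ` R \<union> L\<close>, where \<open>base\<close> forgets
  which copy a row is and \<open>L \<subseteq> J\<close>, then in every finite term of the permanent each column
  \<open>i \<in> base ` R\<close> is used by a copy of \<open>i\<close>. So a term amounts to a choice, for every \<open>i\<close> with both
  copies in \<open>R\<close>, of the copy that is sent to \<open>L\<close>, together with a bijection onto \<open>L\<close>: by
  distributivity this is the permanent of \<open>\<Sigma>(T)\<close> on the doubled rows and the columns \<open>L\<close>.

  It remains to bring an arbitrary non-singular submatrix, with unique optimal matching \<open>\<sigma>\<close>, into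
  this shape. If a column \<open>k \<in> base ` R\<close> is missing, then replacing \<open>\<sigma> r\<close> by \<open>k\<close> preserves
  non-singularity for at least one copy \<open>r\<close> of \<open>k\<close> in \<open>R\<close>. Otherwise, both copies \<open>r1\<close>, \<open>r2\<close> are
  present and there are matchings \<open>\<tau>\<close> and \<open>\<rho>\<close> at least as good as those derived from \<open>\<sigma>\<close>, the first
  using \<open>k\<close> in row \<open>r2\<close> and the second in row \<open>r1\<close>. Dropping these two entries, adding \<open>(r1, \<sigma> r1)\<close>
  and \<open>(r2, \<sigma> r2)\<close>, and decomposing the resulting 2-regular bipartite multigraph yields two
  matchings of the original submatrix of total cost at most twice that of \<open>\<sigma>\<close> but not both equal to
  \<open>\<sigma>\<close>.
\<close>

section \<open>Sums with a tangible value\<close>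

text \<open>This is absorption: \<open>Tangible a + s = Tangible a\<close> holds exactly if
  \<open>above a s\<close>. The inequality is strict also for ghosts, because a tie with anything
  finite produces a ghost.\<close>

definition above :: "real \<Rightarrow> supertrop \<Rightarrow> bool" where
  "above a s = (case s of Tangible b \<Rightarrow> a < b | Ghost b \<Rightarrow> a < b | Infty \<Rightarrow> True)"

lemma above_add: "above a (s + t) \<longleftrightarrow> above a s \<and> above a t"
  by (cases s; cases t) (auto simp: above_def)

lemma above_zero [simp]: "above a 0"
  by (simp add: above_def zero_supertrop_def)

lemma above_sum: "finite X \<Longrightarrow> above a (sum g X) \<longleftrightarrow> (\<forall>x\<in>X. above a (g x))"
  by (induction X rule: finite_induct) (auto simp: above_add)

lemma add_eq_Tangible_iff:
  "s + t = Tangible a \<longleftrightarrow> s = Tangible a \<and> above a t \<or> above a s \<and> t = Tangible a"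
  by (cases s; cases t) (auto simp: above_def)

lemma sum_eq_TangibleD:
  assumes "finite X" "sum g X = Tangible a"
  shows "\<exists>x\<in>X. g x = Tangible a \<and> (\<forall>y\<in>X - {x}. above a (g y))"
  using assms
proof (induction X rule: finite_induct)
  case empty
  then show ?case by (simp add: zero_supertrop_def)
next
  case (insert z X)
  then have "g z = Tangible a \<and> above a (sum g X) \<or> above a (g z) \<and> sum g X = Tangible a"
    by (simp add: add_eq_Tangible_iff)
  then show ?case
  proof
    assume "g z = Tangible a \<and> above a (sum g X)"
    then show ?thesis using insert.hyps above_sum by blast
  next
    assume *: "above a (g z) \<and> sum g X = Tangible a"
    then obtain x where "x \<in> X" "g x = Tangible a" "\<forall>y\<in>X - {x}. above a (g y)"
      using insert.IH by blast
    then show ?thesis using * by (intro bexI[of _ x]) auto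
  qed
qed

text \<open>Addition takes a minimum, and a minimum that is attained twice or by a ghost makes the
  sum a ghost. So a tangible sum means a finite minimum attained by a single summand, which is
  itself tangible.\<close>

lemma tangible_sum_iff:
  assumes "finite X"
  shows "tangible (sum g X) \<longleftrightarrow>
    (\<exists>a. \<exists>x\<in>X. g x = Tangible a \<and> (\<forall>y\<in>X - {x}. above a (g y)))"
proof
  assume "tangible (sum g X)"
  then show "\<exists>a. \<exists>x\<in>X. g x = Tangible a \<and> (\<forall>y\<in>X - {x}. above a (g y))"
    using sum_eq_TangibleD[OF assms] unfolding tangible_def by blast
next
  assume "\<exists>a. \<exists>x\<in>X. g x = Tangible a \<and> (\<forall>y\<in>X - {x}. above a (g y))"
  then obtain a x where x: "x \<in> X" "g x = Tangible a" "\<forall>y\<in>X - {x}. above a (g y)"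
    by blast
  have "sum g X = g x + sum g (X - {x})"
    using assms x(1) by (rule sum.remove)
  also have "\<dots> = Tangible a"
    using x assms by (simp add: add_eq_Tangible_iff above_sum)
  finally show "tangible (sum g X)" by (auto simp: tangible_def)
qed

section \<open>Non-singularity as uniqueness of an optimal matching\<close>

text \<open>The value at \<open>TInfty\<close> is irrelevant: costs are compared only for matchings, which avoid it.\<close>
fun trop_val :: "trop \<Rightarrow> real" where
  "trop_val (Fin a) = a"
| "trop_val TInfty = 0"

definition cost :: "('r \<Rightarrow> 'c \<Rightarrow> trop) \<Rightarrow> 'r set \<Rightarrow> ('r \<Rightarrow> 'c) \<Rightarrow> real" where
  "cost T R \<sigma> = (\<Sum>r\<in>R. trop_val (T r (\<sigma> r)))"

definition matching :: "('r \<Rightarrow> 'c \<Rightarrow> trop) \<Rightarrow> 'r set \<Rightarrow> 'c set \<Rightarrow> ('r \<Rightarrow> 'c) \<Rightarrow> bool" where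
  "matching T R C \<sigma> \<longleftrightarrow> bij_betw \<sigma> R C \<and> (\<forall>r\<in>R. T r (\<sigma> r) \<noteq> TInfty)"

text \<open>Competitors count as different only if they differ on \<open>R\<close>: matchings are
  arbitrary functions here, so that \<open>fun_upd\<close> can be applied to them without tracking
  extensionality.\<close>

definition unique_optimum :: "('r \<Rightarrow> 'c \<Rightarrow> trop) \<Rightarrow> 'r set \<Rightarrow> 'c set \<Rightarrow> ('r \<Rightarrow> 'c) \<Rightarrow> bool" where
  "unique_optimum T R C \<sigma> \<longleftrightarrow> matching T R C \<sigma> \<and>
     (\<forall>\<tau>. matching T R C \<tau> \<longrightarrow> (\<exists>r\<in>R. \<tau> r \<noteq> \<sigma> r) \<longrightarrow> cost T R \<sigma> < cost T R \<tau>)"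

lemma prod_supertrop_matrix:
  assumes "finite R"
  shows "(\<Prod>r\<in>R. supertrop_matrix T r (\<sigma> r)) =
    (if \<forall>r\<in>R. T r (\<sigma> r) \<noteq> TInfty then Tangible (cost T R \<sigma>) else Infty)"
  using assms
proof (induction R rule: finite_induct)
  case empty
  then show ?case by (simp add: cost_def one_supertrop_def)
next
  case (insert x R)
  then show ?case
    by (cases "T x (\<sigma> x)") (auto simp: cost_def supertrop_matrix_def)
qed

lemma matching_restrict: "matching T R C (restrict \<sigma> R) \<longleftrightarrow> matching T R C \<sigma>"
  unfolding matching_def by (intro conj_cong bij_betw_cong ball_cong) auto

lemma cost_restrict: "cost T R (restrict \<sigma> R) = cost T R \<sigma>"
  by (simp add: cost_def)

text \<open>The entries contain no ghosts, so each term of the permanent is \<open>Infty\<close> or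
  the tangible cost of a matching, and \<open>tangible_sum_iff\<close> applies. Restriction to
  \<open>R\<close> passes from matchings to the extensional functions that index the
  permanent.\<close>

lemma trop_nonsingular_iff_unique_optimum:
  assumes "finite R" "finite C"
  shows "trop_nonsingular R C (supertrop_matrix T) \<longleftrightarrow> (\<exists>\<sigma>. unique_optimum T R C \<sigma>)"
proof -
  let ?X = "{\<sigma> \<in> R \<rightarrow>\<^sub>E C. bij_betw \<sigma> R C}"
  let ?g = "\<lambda>\<sigma>. \<Prod>r\<in>R. supertrop_matrix T r (\<sigma> r)"
  have fin: "finite ?X" using assms by (auto intro: finite_subset[OF _ finite_PiE[of R "\<lambda>_. C"]])
  have restr: "restrict \<sigma> R \<in> ?X" if "matching T R C \<sigma>" for \<sigma>
  proof -
    have "bij_betw (restrict \<sigma> R) R C" using that matching_restrict unfolding matching_def by metis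
    then show ?thesis by (auto simp: bij_betw_def)
  qed
  have tang: "?g \<sigma> = Tangible a \<longleftrightarrow> matching T R C \<sigma> \<and> a = cost T R \<sigma>" if "\<sigma> \<in> ?X" for \<sigma> a
    using that by (auto simp: prod_supertrop_matrix[OF assms(1)] matching_def)
  have abv: "above a (?g \<sigma>) \<longleftrightarrow> (matching T R C \<sigma> \<longrightarrow> a < cost T R \<sigma>)" if "\<sigma> \<in> ?X" for \<sigma> a
    using that by (auto simp: prod_supertrop_matrix[OF assms(1)] matching_def above_def)
  have eq: "(\<exists>x\<in>?X. ?g x = Tangible a \<and> (\<forall>y\<in>?X - {x}. above a (?g y))) \<longleftrightarrow>
    (\<exists>\<sigma>\<in>?X. (matching T R C \<sigma> \<and> a = cost T R \<sigma>) \<and>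
      (\<forall>\<tau>\<in>?X - {\<sigma>}. matching T R C \<tau> \<longrightarrow> a < cost T R \<tau>))" for a
    by (intro bex_cong conj_cong ball_cong refl tang abv) auto
  have "trop_nonsingular R C (supertrop_matrix T) \<longleftrightarrow>
    (\<exists>\<sigma>\<in>?X. matching T R C \<sigma> \<and> (\<forall>\<tau>\<in>?X - {\<sigma>}. matching T R C \<tau> \<longrightarrow> cost T R \<sigma> < cost T R \<tau>))"
    unfolding trop_nonsingular_def permanent_def tangible_sum_iff[OF fin] eq by blast
  also have "\<dots> \<longleftrightarrow> (\<exists>\<sigma>. unique_optimum T R C \<sigma>)"
  proof
    assume "\<exists>\<sigma>\<in>?X. matching T R C \<sigma> \<and>
      (\<forall>\<tau>\<in>?X - {\<sigma>}. matching T R C \<tau> \<longrightarrow> cost T R \<sigma> < cost T R \<tau>)"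
    then obtain \<sigma> where \<sigma>: "\<sigma> \<in> ?X" "matching T R C \<sigma>"
      and opt: "\<And>\<tau>. \<tau> \<in> ?X - {\<sigma>} \<Longrightarrow> matching T R C \<tau> \<Longrightarrow> cost T R \<sigma> < cost T R \<tau>" by blast
    have "cost T R \<sigma> < cost T R \<tau>" if "matching T R C \<tau>" "\<exists>r\<in>R. \<tau> r \<noteq> \<sigma> r" for \<tau>
    proof -
      have "restrict \<tau> R \<noteq> \<sigma>" using that(2) by (metis restrict_apply')
      then show ?thesis using opt[of "restrict \<tau> R"] restr[OF that(1)] that(1)
        by (simp add: matching_restrict cost_restrict)
    qed
    then show "\<exists>\<sigma>. unique_optimum T R C \<sigma>" using \<sigma>(2) unfolding unique_optimum_def by blast
  next
    assume "\<exists>\<sigma>. unique_optimum T R C \<sigma>"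
    then obtain \<sigma> where \<sigma>: "matching T R C \<sigma>"
      and opt: "\<And>\<tau>. matching T R C \<tau> \<Longrightarrow> \<exists>r\<in>R. \<tau> r \<noteq> \<sigma> r \<Longrightarrow> cost T R \<sigma> < cost T R \<tau>"
      unfolding unique_optimum_def by blast
    have "cost T R \<sigma> < cost T R \<tau>" if "\<tau> \<in> ?X - {restrict \<sigma> R}" "matching T R C \<tau>" for \<tau>
    proof -
      have "\<exists>r\<in>R. \<tau> r \<noteq> \<sigma> r"
        using that(1) by (auto simp: PiE_def extensional_def restrict_def fun_eq_iff split: if_splits)
      then show ?thesis using opt that(2) by blast
    qed
    then show "\<exists>\<sigma>\<in>?X. matching T R C \<sigma> \<and>
      (\<forall>\<tau>\<in>?X - {\<sigma>}. matching T R C \<tau> \<longrightarrow> cost T R \<sigma> < cost T R \<tau>)"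
      using restr[OF \<sigma>] \<sigma> by (intro bexI[of _ "restrict \<sigma> R"]) (auto simp: matching_restrict cost_restrict)
  qed
  finally show ?thesis .
qed

section \<open>Recombining matchings and exchanging a column\<close>

lemma bij_betw_if_surj_card:
  assumes "finite R" "bij_betw f R C" "g ` R = C"
  shows "bij_betw g R C"
  using assms by (metis bij_betw_def bij_betw_same_card eq_card_imp_inj_on)

text \<open>The edges of \<open>f\<close> and \<open>g\<close> form a 2-regular bipartite
  multigraph. It stays 2-regular when row \<open>r1\<close> gives up \<open>g r1\<close> to
  \<open>r2\<close> and receives \<open>f r2\<close> from it; \<open>f'\<close> and
  \<open>g'\<close> are a decomposition of the new multigraph into two bijections.\<close>

lemma recombine_bijections:
  assumes fin: "finite R" and f: "bij_betw f R C" and g: "bij_betw g R C"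
    and r: "r1 \<in> R" "r2 \<in> R" "r1 \<noteq> r2"
  obtains f' g' where "bij_betw f' R C" "bij_betw g' R C"
    "\<And>x. x \<in> R - {r1, r2} \<Longrightarrow> f' x = f x \<and> g' x = g x \<or> f' x = g x \<and> g' x = f x"
    "f' r1 = f r2" "g' r1 = f r1"
    "f' r2 = g r1 \<and> g' r2 = g r2 \<or> f' r2 = g r2 \<and> g' r2 = g r1"
proof -
  define h where "h x = inv_into R g (f x)" for x
  have hR: "h x \<in> R" and gh: "g (h x) = f x" if "x \<in> R" for x
    using that f g unfolding h_def bij_betw_def
    by (metis imageI inv_into_into, metis imageI f_inv_into_f)
  have inj_h: "inj_on h R"
    using gh f by (metis bij_betw_def inj_on_def)
  txt \<open>\<open>P\<close> is the set of rows on the path that leaves \<open>r1\<close> along \<open>f\<close> and alternates between \<open>f\<close> and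
    \<open>g\<close>, stopped at \<open>r2\<close>. The roles of \<open>f\<close> and \<open>g\<close> are exchanged on \<open>P\<close>.\<close>
  define P where "P = lfp (\<lambda>X. insert r1 (h ` (X - {r2})))"
  have P: "P = insert r1 (h ` (P - {r2}))"
    unfolding P_def by (rule lfp_unfold) (auto simp: mono_def)
  have "P \<subseteq> R"
    unfolding P_def by (rule lfp_lowerbound) (use r hR in auto)
  then have finP: "finite P" using fin finite_subset by blast
  have r1P: "r1 \<in> P" using P by blast
  have g_h: "g ` (h ` X) = f ` X" if "X \<subseteq> R" for X
    using that gh by (force simp: image_image)
  have fR: "f ` R = C" and gR: "g ` R = C" using f g by (auto simp: bij_betw_def)
  show thesis
  proof (cases "r2 \<in> P")
    case False
    \<comment> \<open>The path misses \<open>r2\<close>, so it closes up to the cycle of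
      \<open>h\<close> through \<open>r1\<close>. On a whole cycle \<open>f\<close> and
      \<open>g\<close> have the same image and can be exchanged.\<close>
    then have "h ` P \<subseteq> P" using P by auto
    moreover have "card (h ` P) = card P"
      using inj_h \<open>P \<subseteq> R\<close> by (meson card_image inj_on_subset)
    ultimately have "h ` P = P" using finP card_subset_eq by blast
    then have gP: "g ` P = f ` P" using g_h[OF \<open>P \<subseteq> R\<close>] by simp
    define u where "u x = (if x \<in> P then g x else f x)" for x
    \<comment> \<open>Since \<open>u r1 = g r1\<close> and \<open>u r2 = f r2\<close>, this only
      transposes two values of \<open>u\<close>.\<close>
    define f' where "f' = u(r1 := f r2, r2 := g r1)"
    define g' where "g' x = (if x \<in> P then f x else g x)" for x
    have split: "k ` R = k ` P \<union> k ` (R - P)" for k :: "'a \<Rightarrow> 'b" using \<open>P \<subseteq> R\<close> by blast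
    have "u ` R = g ` P \<union> f ` (R - P)" using split[of u] by (auto simp: u_def)
    then have uR: "u ` R = C" using gP fR split[of f] by simp
    have "g' ` R = f ` P \<union> g ` (R - P)" using split[of g'] by (auto simp: g'_def)
    then have g'R: "g' ` R = C" using gP gR split[of g] by simp
    have u12: "u r1 = g r1" "u r2 = f r2" using r1P False by (auto simp: u_def)
    have R: "R = insert r1 (insert r2 (R - {r1, r2}))" using r by blast
    have "k ` R = insert (k r1) (insert (k r2) (k ` (R - {r1, r2})))" for k :: "'a \<Rightarrow> 'b"
      by (subst R) (simp only: image_insert)
    from this[of f'] this[of u]
    have "f' ` R = u ` R" using r u12 by (auto simp: f'_def)
    then have "bij_betw f' R C" using bij_betw_if_surj_card[OF fin f] uR by simp
    moreover have "bij_betw g' R C" using bij_betw_if_surj_card[OF fin f] g'R by simp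
    ultimately show thesis
      by (rule that) (use r1P False r in \<open>auto simp: f'_def g'_def u_def\<close>)
  next
    case True
    \<comment> \<open>The path ends at \<open>r2\<close> without returning to \<open>r1\<close>:
      otherwise \<open>h\<close> would map \<open>P - {r2}\<close> onto the larger set
      \<open>P\<close>.\<close>
    have "r1 \<notin> h ` (P - {r2})"
    proof
      assume "r1 \<in> h ` (P - {r2})"
      then have "card P = card (h ` (P - {r2}))" using P by (metis insert_absorb)
      also have "\<dots> \<le> card (P - {r2})" using finP by (simp add: card_image_le)
      also have "\<dots> < card P" using finP True by (rule card_Diff1_less)
      finally show False by simp
    qed
    then have "h ` (P - {r2}) = P - {r1}" using P by blast
    then have gP: "g ` (P - {r1}) = f ` (P - {r2})" using g_h[of "P - {r2}"] \<open>P \<subseteq> R\<close> by auto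
    define f' where "f' x = (if x = r1 then f r2 else if x \<in> P then g x else f x)" for x
    define g' where "g' x = (if x = r2 then g r1 else if x \<in> P then f x else g x)" for x
    have split: "k ` R = insert (k y) (k ` (P - {y}) \<union> k ` (R - P))" if "y \<in> P"
      for k :: "'a \<Rightarrow> 'b" and y using \<open>P \<subseteq> R\<close> that by blast
    have "f' ` (P - {r1}) = g ` (P - {r1})" "f' ` (R - P) = f ` (R - P)"
      using r1P by (auto simp: f'_def intro!: image_cong)
    then have "f' ` R = f ` R"
      using split[OF r1P, of f'] split[OF True, of f] gP by (simp add: f'_def)
    moreover have "g' ` (P - {r2}) = f ` (P - {r2})" "g' ` (R - P) = g ` (R - P)"
      using True by (auto simp: g'_def intro!: image_cong)
    then have "g' ` R = g ` R"
      using split[OF True, of g'] split[OF r1P, of g] gP by (simp add: g'_def)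
    ultimately have "bij_betw f' R C" "bij_betw g' R C"
      using bij_betw_if_surj_card[OF fin f] fR gR by auto
    then show thesis
      by (rule that) (use r1P True r in \<open>auto simp: f'_def g'_def\<close>)
  qed
qed

lemma bij_betw_fun_upd:
  assumes bij: "bij_betw \<tau> R C" and "r \<in> R" "c \<notin> C"
  shows "bij_betw (\<tau>(r := c)) R (insert c (C - {\<tau> r}))"
proof -
  have "bij_betw \<tau> (R - {r}) (C - {\<tau> r})"
    using bij assms(2) by (simp add: bij_betw_DiffI bij_betw_apply)
  then have "bij_betw (\<tau>(r := c)) (R - {r}) (C - {\<tau> r})"
    by (rule bij_betw_cong[THEN iffD1, rotated]) auto
  then show ?thesis
    using notIn_Un_bij_betw3[of r "R - {r}" "\<tau>(r := c)" "C - {\<tau> r}"] assms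
    by (simp add: insert_absorb)
qed

lemma matching_fun_upd:
  assumes "matching T R C \<tau>" "r \<in> R" "c \<notin> C" "T r c \<noteq> TInfty"
  shows "matching T R (insert c (C - {\<tau> r})) (\<tau>(r := c))"
  using assms bij_betw_fun_upd by (auto simp: matching_def)

lemma cost_fun_upd:
  assumes "finite R" "r \<in> R"
  shows "cost T R (\<sigma>(r := c)) = cost T R \<sigma> - trop_val (T r (\<sigma> r)) + trop_val (T r c)"
proof -
  have "(\<Sum>x\<in>R - {r}. trop_val (T x ((\<sigma>(r := c)) x))) = (\<Sum>x\<in>R - {r}. trop_val (T x (\<sigma> x)))"
    by (rule sum.cong) auto
  then show ?thesis
    unfolding cost_def using sum.remove[OF assms, of "\<lambda>x. trop_val (T x (\<sigma> x))"]
      sum.remove[OF assms, of "\<lambda>x. trop_val (T x ((\<sigma>(r := c)) x))"] by simp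
qed

text \<open>If a competitor of \<open>\<sigma>(r := k)\<close> also used \<open>k\<close> in row
  \<open>r\<close>, resetting that entry to \<open>\<sigma> r\<close> would shift both costs by the
  same amount and yield a competitor of \<open>\<sigma>\<close> itself.\<close>

lemma exchange_column_competitor:
  assumes fin: "finite R" and \<sigma>: "unique_optimum T R C \<sigma>" and k: "k \<notin> C"
    and r: "r \<in> R" "T r k \<noteq> TInfty"
    and not_opt: "\<not> unique_optimum T R (insert k (C - {\<sigma> r})) (\<sigma>(r := k))"
  obtains \<tau> where "matching T R (insert k (C - {\<sigma> r})) \<tau>" "\<tau> r \<noteq> k"
    "cost T R \<tau> \<le> cost T R \<sigma> - trop_val (T r (\<sigma> r)) + trop_val (T r k)"
proof -
  have m: "matching T R C \<sigma>" using \<sigma> by (simp add: unique_optimum_def)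
  then have \<sigma>r: "\<sigma> r \<in> C" "T r (\<sigma> r) \<noteq> TInfty"
    using r(1) by (auto simp: matching_def bij_betw_apply)
  obtain \<tau> where \<tau>: "matching T R (insert k (C - {\<sigma> r})) \<tau>" "\<exists>x\<in>R. \<tau> x \<noteq> (\<sigma>(r := k)) x"
    "cost T R \<tau> \<le> cost T R (\<sigma>(r := k))"
    using not_opt matching_fun_upd[OF m r(1) k r(2)] unfolding unique_optimum_def
    by (meson linorder_not_less)
  have "\<tau> r \<noteq> k"
  proof
    assume \<tau>r: "\<tau> r = k"
    have "insert (\<sigma> r) (insert k (C - {\<sigma> r}) - {\<tau> r}) = C" "\<sigma> r \<notin> insert k (C - {\<sigma> r})"
      using k \<sigma>r(1) \<tau>r by auto
    then have "matching T R C (\<tau>(r := \<sigma> r))"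
      using matching_fun_upd[OF \<tau>(1) r(1) _ \<sigma>r(2)] by simp
    moreover have "\<exists>x\<in>R. (\<tau>(r := \<sigma> r)) x \<noteq> \<sigma> x" using \<tau>(2) \<tau>r by (auto split: if_splits)
    ultimately have "cost T R \<sigma> < cost T R (\<tau>(r := \<sigma> r))"
      using \<sigma> by (simp add: unique_optimum_def)
    then show False using \<tau>(3) \<tau>r by (simp add: cost_fun_upd[OF fin r(1)])
  qed
  with \<tau>(1) show thesis
    by (rule that) (use \<tau>(3) in \<open>simp add: cost_fun_upd[OF fin r(1)]\<close>)
qed

text \<open>The case \<open>r1 = r2\<close> is included on purpose: it covers a column
  \<open>k\<close> of which only one copy lies in \<open>R\<close>. A competitor avoiding
  \<open>k\<close> in that row would then leave column \<open>k\<close> uncovered.\<close>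

lemma exchange_column:
  assumes fin: "finite R" and \<sigma>: "unique_optimum T R C \<sigma>" and k: "k \<notin> C"
    and supp: "{r \<in> R. T r k \<noteq> TInfty} = {r1, r2}"
  shows "\<exists>r\<in>{r1, r2}. unique_optimum T R (insert k (C - {\<sigma> r})) (\<sigma>(r := k))"
proof (rule ccontr)
  assume neg: "\<not> ?thesis"
  have r1: "r1 \<in> R" "T r1 k \<noteq> TInfty" and r2: "r2 \<in> R" "T r2 k \<noteq> TInfty" using supp by blast+
  have m: "matching T R C \<sigma>" using \<sigma> by (simp add: unique_optimum_def)
  obtain \<tau> where \<tau>: "matching T R (insert k (C - {\<sigma> r1})) \<tau>" "\<tau> r1 \<noteq> k"
    and \<tau>_cost: "cost T R \<tau> \<le> cost T R \<sigma> - trop_val (T r1 (\<sigma> r1)) + trop_val (T r1 k)"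
    using exchange_column_competitor[OF fin \<sigma> k r1] neg by blast
  obtain \<rho> where \<rho>: "matching T R (insert k (C - {\<sigma> r2})) \<rho>" "\<rho> r2 \<noteq> k"
    and \<rho>_cost: "cost T R \<rho> \<le> cost T R \<sigma> - trop_val (T r2 (\<sigma> r2)) + trop_val (T r2 k)"
    using exchange_column_competitor[OF fin \<sigma> k r2] neg by blast
  \<comment> \<open>Column \<open>k\<close> has to be covered by a row with a finite entry
    there.\<close>
  have hit: "\<exists>x\<in>{r1, r2}. \<phi> x = k" if "matching T R (insert k D) \<phi>" for \<phi> D
  proof -
    have "\<phi> ` R = insert k D" using that by (simp add: matching_def bij_betw_imp_surj_on)
    then have "k \<in> \<phi> ` R" by blast
    then obtain x where "x \<in> R" "\<phi> x = k" by blast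
    then show ?thesis using that supp unfolding matching_def by blast
  qed
  have \<tau>r2: "\<tau> r2 = k" and \<rho>r1: "\<rho> r1 = k" using hit \<tau> \<rho> by blast+
  then have ne: "r1 \<noteq> r2" using \<tau>(2) by blast
  have \<sigma>C: "\<sigma> r1 \<in> C" "\<sigma> r2 \<in> C" and \<sigma>fin: "T r1 (\<sigma> r1) \<noteq> TInfty" "T r2 (\<sigma> r2) \<noteq> TInfty"
    using m r1 r2 by (auto simp: matching_def bij_betw_apply)
  \<comment> \<open>These are bijections onto \<open>C\<close>, but perhaps not matchings: the new
    entries \<open>(r2, \<sigma> r1)\<close> and \<open>(r1, \<sigma> r2)\<close> may be infinite.
    Recombination moves \<open>\<sigma> r1\<close> to row \<open>r1\<close> and
    \<open>\<sigma> r2\<close> to row \<open>r2\<close>, where the entries are finite.\<close>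
  define f where "f = \<tau>(r2 := \<sigma> r1)"
  define g where "g = \<rho>(r1 := \<sigma> r2)"
  have C: "insert (\<sigma> r1) (insert k (C - {\<sigma> r1}) - {k}) = C"
    "insert (\<sigma> r2) (insert k (C - {\<sigma> r2}) - {k}) = C" using k \<sigma>C by auto
  have "\<sigma> r1 \<notin> insert k (C - {\<sigma> r1})" "\<sigma> r2 \<notin> insert k (C - {\<sigma> r2})" using k \<sigma>C by auto
  moreover have "bij_betw \<tau> R (insert k (C - {\<sigma> r1}))" "bij_betw \<rho> R (insert k (C - {\<sigma> r2}))"
    using \<tau>(1) \<rho>(1) by (simp_all add: matching_def)
  ultimately have f: "bij_betw f R C" and g: "bij_betw g R C"
    using bij_betw_fun_upd[of \<tau> R _ r2 "\<sigma> r1"] bij_betw_fun_upd[of \<rho> R _ r1 "\<sigma> r2"]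
      C \<tau>r2 r2(1) \<rho>r1 r1(1) unfolding f_def g_def by metis+
  obtain f' g' where f': "bij_betw f' R C" and g': "bij_betw g' R C"
    and rest: "\<And>x. x \<in> R - {r1, r2} \<Longrightarrow> f' x = f x \<and> g' x = g x \<or> f' x = g x \<and> g' x = f x"
    and at1: "f' r1 = f r2" "g' r1 = f r1"
    and at2: "f' r2 = g r1 \<and> g' r2 = g r2 \<or> f' r2 = g r2 \<and> g' r2 = g r1"
    using recombine_bijections[OF fin f g r1(1) r2(1) ne] by blast
  have \<tau>fin: "T x (\<tau> x) \<noteq> TInfty" and \<rho>fin: "T x (\<rho> x) \<noteq> TInfty" if "x \<in> R" for x
    using that \<tau>(1) \<rho>(1) by (auto simp: matching_def)
  have rest': "f' x = \<tau> x \<and> g' x = \<rho> x \<or> f' x = \<rho> x \<and> g' x = \<tau> x" if "x \<in> R - {r1, r2}" for x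
    using rest[OF that] that by (auto simp: f_def g_def)
  have at1': "f' r1 = \<sigma> r1" "g' r1 = \<tau> r1" using at1 ne by (auto simp: f_def)
  have at2': "f' r2 = \<sigma> r2 \<and> g' r2 = \<rho> r2 \<or> f' r2 = \<rho> r2 \<and> g' r2 = \<sigma> r2"
    using at2 ne by (auto simp: g_def)
  have "T x (f' x) \<noteq> TInfty \<and> T x (g' x) \<noteq> TInfty" if "x \<in> R" for x
  proof (cases "x \<in> {r1, r2}")
    case True
    then show ?thesis using at1' at2' \<tau>fin \<rho>fin \<sigma>fin that by auto
  next
    case False
    then show ?thesis using rest'[of x] \<tau>fin[of x] \<rho>fin[of x] that by auto
  qed
  then have mf': "matching T R C f'" and mg': "matching T R C g'"
    using f' g' by (auto simp: matching_def)
  have split: "cost T R \<phi> =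
      trop_val (T r1 (\<phi> r1)) + (trop_val (T r2 (\<phi> r2)) + cost T (R - {r1, r2}) \<phi>)" for \<phi>
  proof -
    have "R - {r1} - {r2} = R - {r1, r2}" by blast
    then show ?thesis
      unfolding cost_def
      using sum.remove[OF fin r1(1), of "\<lambda>r. trop_val (T r (\<phi> r))"]
        sum.remove[of "R - {r1}" r2 "\<lambda>r. trop_val (T r (\<phi> r))"] fin r2(1) ne
      by simp
  qed
  have "cost T (R - {r1, r2}) f' + cost T (R - {r1, r2}) g' =
      cost T (R - {r1, r2}) \<tau> + cost T (R - {r1, r2}) \<rho>"
    unfolding cost_def sum.distrib[symmetric] by (rule sum.cong) (use rest' in force)+
  then have "cost T R f' + cost T R g' = cost T R \<tau> + cost T R \<rho>
      - trop_val (T r2 k) - trop_val (T r1 k) + trop_val (T r1 (\<sigma> r1)) + trop_val (T r2 (\<sigma> r2))"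
    using at1' at2' \<tau>r2 \<rho>r1 split[of f'] split[of g'] split[of \<tau>] split[of \<rho>] by auto
  \<comment> \<open>The four entries in rows \<open>r1\<close> and \<open>r2\<close> cancel against
    those in the bounds for \<open>\<tau>\<close> and \<open>\<rho>\<close>.\<close>
  then have le: "cost T R f' + cost T R g' \<le> 2 * cost T R \<sigma>" using \<tau>_cost \<rho>_cost by simp
  have opt: "cost T R \<sigma> \<le> cost T R \<phi> \<and> ((\<exists>x\<in>R. \<phi> x \<noteq> \<sigma> x) \<longrightarrow> cost T R \<sigma> < cost T R \<phi>)"
    if "matching T R C \<phi>" for \<phi>
  proof (cases "\<exists>x\<in>R. \<phi> x \<noteq> \<sigma> x")
    case True
    then have "cost T R \<sigma> < cost T R \<phi>" using \<sigma> that by (simp add: unique_optimum_def)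
    then show ?thesis by simp
  next
    case False
    then show ?thesis by (simp add: cost_def)
  qed
  \<comment> \<open>Neither cost is below that of \<open>\<sigma>\<close>, so both are equal to it
    and \<open>g'\<close> agrees with \<open>\<sigma>\<close> on \<open>R\<close>. But
    \<open>g' r1 = \<tau> r1\<close>, and \<open>\<tau>\<close> omits the column
    \<open>\<sigma> r1\<close>.\<close>
  have "\<not> (\<exists>x\<in>R. g' x \<noteq> \<sigma> x)" using opt[OF mf'] opt[OF mg'] le by linarith
  then have "\<tau> r1 = \<sigma> r1" using at1'(2) r1(1) by metis
  moreover have "\<tau> r1 \<in> insert k (C - {\<sigma> r1})"
    using \<tau>(1) r1(1) bij_betw_apply unfolding matching_def by metis
  ultimately show False using \<tau>(2) by simp
qed

section \<open>The permanent of a matrix with copied rows\<close>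

definition base :: "'a + 'a \<Rightarrow> 'a" where
  "base = case_sum id id"

lemma base_simps [simp]: "base (Inl i) = i" "base (Inr i) = i"
  by (simp_all add: base_def)

lemma base_eqD: "base r = i \<Longrightarrow> r = Inl i \<or> r = Inr i"
  by (cases r) auto

lemma permanent_copies:
  fixes A :: "'a + 'a \<Rightarrow> 'a \<Rightarrow> supertrop"
  assumes fin: "finite R" "finite L" and disj: "L \<inter> base ` R = {}"
    and diag: "\<And>r. r \<in> R \<Longrightarrow> A r (base r) = 1"
    and off: "\<And>r i. r \<in> R \<Longrightarrow> i \<in> base ` R \<Longrightarrow> i \<noteq> base r \<Longrightarrow> A r i = 0"
    and D: "D = {i. Inl i \<in> R \<and> Inr i \<in> R}"
  shows "permanent R (base ` R \<union> L) A = permanent D L (\<lambda>i j. A (Inl i) j + A (Inr i) j)"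
proof -
  let ?C = "base ` R \<union> L"
  define B where "B = {\<sigma> \<in> D \<rightarrow>\<^sub>E L. bij_betw \<sigma> D L}"
  define S :: "('a \<Rightarrow> 'a + 'a) set" where "S = (\<Pi>\<^sub>E i\<in>D. {Inl i, Inr i})"
  define \<Phi> where "\<Phi> = {\<phi> \<in> R \<rightarrow>\<^sub>E ?C. bij_betw \<phi> R ?C}"
  \<comment> \<open>These bijections index the terms that avoid the zero entries given by
    \<open>off\<close>.\<close>
  define \<Phi>0 where "\<Phi>0 = {\<phi> \<in> \<Phi>. \<forall>r\<in>R. \<phi> r \<in> L \<or> \<phi> r = base r}"
  \<comment> \<open>For \<open>\<phi>\<close> in \<open>\<Phi>0\<close> this is the one copy of
    \<open>i\<close> that is sent to \<open>L\<close>. The default \<open>Inr i\<close> is correct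
    because exactly one of the two copies is.\<close>
  define t :: "('a + 'a \<Rightarrow> 'a) \<Rightarrow> 'a \<Rightarrow> 'a + 'a" where
    "t \<phi> = (\<lambda>i\<in>D. if \<phi> (Inl i) \<in> L then Inl i else Inr i)" for \<phi>
  define split where "split \<phi> = ((\<lambda>i\<in>D. \<phi> (t \<phi> i)), t \<phi>)" for \<phi>
  define merge where "merge p = (\<lambda>r\<in>R. if base r \<in> D \<and> r = snd p (base r)
    then fst p (base r) else base r)" for p :: "('a \<Rightarrow> 'a) \<times> ('a \<Rightarrow> 'a + 'a)"
  have finD: "finite D"
    by (rule finite_subset[OF _ finite_imageI[OF fin(1), of base]]) (force simp: D)
  have fin\<Phi>: "finite \<Phi>"
    unfolding \<Phi>_def using fin by (auto intro: finite_subset[OF _ finite_PiE[of R "\<lambda>_. ?C"]])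
  have DR: "Inl i \<in> R" "Inr i \<in> R" if "i \<in> D" for i using that D by auto
  have baseL: "base r \<notin> L" if "r \<in> R" for r using that disj by blast
  have not_D: "r = r'" if "r \<in> R" "r' \<in> R" "base r = base r'" "base r \<notin> D" for r r'
    using that D by (cases r; cases r') auto
  have t: "t \<phi> i \<in> R" "base (t \<phi> i) = i" if "i \<in> D" for \<phi> i
    using that DR by (auto simp: t_def)
  have inj_t: "inj_on (t \<phi>) D" for \<phi> using t(2) by (metis inj_onI)

  \<comment> \<open>Each column \<open>base r\<close> must be covered by a copy of
    \<open>base r\<close> that does not go to \<open>L\<close>, and by injectivity only one copy can
    cover it. So an unpaired row keeps its own column, and of two copies exactly one goes to
    \<open>L\<close>.\<close>
  have to_L_iff: "\<phi> r \<in> L \<longleftrightarrow> base r \<in> D \<and> r = t \<phi> (base r)" if \<phi>: "\<phi> \<in> \<Phi>0" and r: "r \<in> R" for \<phi> r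
  proof -
    have inj: "inj_on \<phi> R" and img: "\<phi> ` R = ?C"
      using \<phi> by (auto simp: \<Phi>0_def \<Phi>_def bij_betw_def)
    have alt: "\<And>x. x \<in> R \<Longrightarrow> \<phi> x \<in> L \<or> \<phi> x = base x" using \<phi> by (simp add: \<Phi>0_def)
    have hit: "\<exists>x\<in>R. base x = base r \<and> \<phi> x \<notin> L"
    proof -
      have "base r \<in> \<phi> ` R" using img r by blast
      then obtain x where x: "x \<in> R" "\<phi> x = base r" by force
      then have "base x = base r" using alt[OF x(1)] baseL[OF r] by auto
      then show ?thesis using x baseL[OF r] by auto
    qed
    have uniq: "x = y" if "x \<in> R" "y \<in> R" "base x = base y" "\<phi> x \<notin> L" "\<phi> y \<notin> L" for x y
      using that alt inj by (metis inj_onD)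
    show ?thesis
    proof (cases "base r \<in> D")
      case False
      then show ?thesis using hit not_D r by metis
    next
      case True
      define i where "i = base r"
      have "\<phi> (Inl i) \<in> L \<longleftrightarrow> \<phi> (Inr i) \<notin> L"
        using uniq[of "Inl i" "Inr i"] hit base_eqD[of _ i] DR[of i] True i_def by auto
      moreover have "r = Inl i \<or> r = Inr i" using base_eqD i_def by metis
      ultimately show ?thesis using True by (auto simp: t_def i_def[symmetric])
    qed
  qed

  have merge_t: "merge p (snd p i) = fst p i" if "p \<in> B \<times> S" "i \<in> D" for p i
  proof -
    have "snd p i \<in> {Inl i, Inr i}" using that by (auto simp: S_def)
    then show ?thesis using DR[OF that(2)] that(2) by (auto simp: merge_def)
  qed
  have merge_L_iff: "merge p r \<in> L \<longleftrightarrow> base r \<in> D \<and> r = snd p (base r)"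
    if "p \<in> B \<times> S" "r \<in> R" for p r
    using that baseL[of r] by (auto simp: merge_def B_def)

  have "permanent R ?C A = (\<Sum>\<phi>\<in>\<Phi>0. \<Prod>r\<in>R. A r (\<phi> r))"
    unfolding permanent_def \<Phi>_def[symmetric]
  proof (rule sum.mono_neutral_right[OF fin\<Phi>])
    show "\<Phi>0 \<subseteq> \<Phi>" by (auto simp: \<Phi>0_def)
    show "\<forall>\<phi>\<in>\<Phi> - \<Phi>0. (\<Prod>r\<in>R. A r (\<phi> r)) = 0"
    proof
      fix \<phi> assume \<phi>: "\<phi> \<in> \<Phi> - \<Phi>0"
      then obtain r where r: "r \<in> R" "\<phi> r \<notin> L" "\<phi> r \<noteq> base r" by (auto simp: \<Phi>0_def)
      moreover have "\<phi> r \<in> ?C" using \<phi> r(1) by (auto simp: \<Phi>_def)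
      ultimately have "A r (\<phi> r) = 0" using off by blast
      then show "(\<Prod>r\<in>R. A r (\<phi> r)) = 0"
        using prod.remove[OF fin(1) r(1), of "\<lambda>r. A r (\<phi> r)"] by simp
    qed
  qed
  also have "\<dots> = (\<Sum>p\<in>B \<times> S. \<Prod>i\<in>D. A (snd p i) (fst p i))"
  proof (rule sum.reindex_bij_witness[of _ merge split])
    fix \<phi> assume \<phi>: "\<phi> \<in> \<Phi>0"
    then have ext: "\<phi> \<in> extensional R" and inj: "inj_on \<phi> R" and img: "\<phi> ` R = ?C"
      by (auto simp: \<Phi>0_def \<Phi>_def PiE_def bij_betw_def)
    have alt: "\<And>r. r \<in> R \<Longrightarrow> \<phi> r \<notin> L \<Longrightarrow> \<phi> r = base r" using \<phi> by (auto simp: \<Phi>0_def)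
    show "merge (split \<phi>) = \<phi>"
    proof
      fix r show "merge (split \<phi>) r = \<phi> r"
      proof (cases "r \<in> R")
        case True
        then show ?thesis using to_L_iff[OF \<phi> True] alt[OF True]
          by (auto simp: merge_def split_def)
      next
        case False
        then show ?thesis using ext by (simp add: merge_def extensional_def)
      qed
    qed
    have "inj_on (\<lambda>i. \<phi> (t \<phi> i)) D"
      using inj_t[of \<phi>] inj t(1) by (auto simp: inj_on_def)
    moreover have "(\<lambda>i. \<phi> (t \<phi> i)) ` D = L"
    proof (intro equalityI subsetI)
      fix l assume "l \<in> (\<lambda>i. \<phi> (t \<phi> i)) ` D"
      then obtain i where "i \<in> D" "l = \<phi> (t \<phi> i)" by blast
      then show "l \<in> L" using to_L_iff[OF \<phi> t(1)] t(2) by metis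
    next
      fix l assume l: "l \<in> L"
      then have "l \<in> \<phi> ` R" using img by blast
      then obtain r where r: "r \<in> R" "l = \<phi> r" by blast
      then have "base r \<in> D" "r = t \<phi> (base r)" using to_L_iff[OF \<phi> r(1)] l by auto
      then show "l \<in> (\<lambda>i. \<phi> (t \<phi> i)) ` D" using r(2) by (metis image_eqI)
    qed
    ultimately have "bij_betw (\<lambda>i\<in>D. \<phi> (t \<phi> i)) D L" by (simp add: bij_betw_def inj_on_def)
    moreover from this have "(\<lambda>i\<in>D. \<phi> (t \<phi> i)) \<in> D \<rightarrow>\<^sub>E L"
      by (auto simp: bij_betw_def)
    moreover have "t \<phi> \<in> S" by (auto simp: t_def S_def)
    ultimately show "split \<phi> \<in> B \<times> S" by (simp add: split_def B_def)
    \<comment> \<open>Rows that stay on their own column contribute the factor 1.\<close>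
    have "(\<Prod>r\<in>R. A r (\<phi> r)) = (\<Prod>r\<in>t \<phi> ` D. A r (\<phi> r))"
    proof (rule prod.mono_neutral_right[OF fin(1)])
      show "t \<phi> ` D \<subseteq> R" using t(1) by blast
      show "\<forall>r\<in>R - t \<phi> ` D. A r (\<phi> r) = 1"
      proof
        fix r assume r: "r \<in> R - t \<phi> ` D"
        then have "\<phi> r \<notin> L" using to_L_iff[OF \<phi>, of r] by blast
        then show "A r (\<phi> r) = 1" using alt[of r] diag r by simp
      qed
    qed
    also have "\<dots> = (\<Prod>i\<in>D. A (t \<phi> i) (\<phi> (t \<phi> i)))"
      by (simp add: prod.reindex[OF inj_t])
    finally show "(\<Prod>i\<in>D. A (snd (split \<phi>) i) (fst (split \<phi>) i)) = (\<Prod>r\<in>R. A r (\<phi> r))"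
      by (simp add: split_def)
  next
    fix p assume p: "p \<in> B \<times> S"
    have \<sigma>: "bij_betw (fst p) D L" "fst p \<in> extensional D" and s: "snd p \<in> extensional D"
      and s_cases: "\<And>i. i \<in> D \<Longrightarrow> snd p i = Inl i \<or> snd p i = Inr i"
      using p by (auto simp: B_def S_def PiE_def)
    have "t (merge p) i = snd p i" for i
    proof (cases "i \<in> D")
      case True
      then show ?thesis
        using merge_L_iff[OF p, of "Inl i"] DR[OF True] s_cases[OF True] by (auto simp: t_def)
    next
      case False
      then show ?thesis using s by (simp add: t_def extensional_def)
    qed
    then have t_merge: "t (merge p) = snd p" by blast
    moreover have "(\<lambda>i\<in>D. merge p (snd p i)) = fst p"
      using merge_t[OF p] \<sigma>(2) by (auto simp: fun_eq_iff extensional_def)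
    ultimately show "split (merge p) = p" by (simp add: split_def)
    have "inj_on (merge p) R"
    proof (rule inj_onI)
      fix x y assume xy: "x \<in> R" "y \<in> R" "merge p x = merge p y"
      show "x = y"
      proof (cases "merge p x \<in> L")
        case True
        then have x: "base x \<in> D" "x = snd p (base x)" and y: "base y \<in> D" "y = snd p (base y)"
          using merge_L_iff[OF p xy(1)] merge_L_iff[OF p xy(2)] xy(3) by simp_all
        then have "fst p (base x) = fst p (base y)" using xy by (simp add: merge_def)
        then have "base x = base y" using \<sigma>(1) x(1) y(1) by (meson bij_betw_def inj_onD)
        then show ?thesis using x y by simp
      next
        case False
        then have *: "\<not> (base x \<in> D \<and> x = snd p (base x))" "\<not> (base y \<in> D \<and> y = snd p (base y))"
          using merge_L_iff[OF p xy(1)] merge_L_iff[OF p xy(2)] xy(3) by metis+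
        then have eq: "base x = base y" using xy by (auto simp: merge_def)
        show ?thesis
        proof (cases "base x \<in> D")
          case True
          then show ?thesis using * eq s_cases[of "base x"] base_eqD[of x] base_eqD[of y] by metis
        next
          case False
          then show ?thesis using not_D xy eq by blast
        qed
      qed
    qed
    moreover have "merge p ` R = ?C"
    proof (intro equalityI subsetI)
      fix c assume "c \<in> merge p ` R"
      then obtain r where r: "r \<in> R" "c = merge p r" by blast
      show "c \<in> ?C"
      proof (cases "c \<in> L")
        case False
        then have "c = base r" using merge_L_iff[OF p r(1)] r by (auto simp: merge_def)
        then show ?thesis using r by blast
      qed simp
    next
      fix c assume "c \<in> ?C"
      then consider "c \<in> L" | "c \<in> base ` R" "c \<in> D" | "c \<in> base ` R" "c \<notin> D" by blast
      then show "c \<in> merge p ` R"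
      proof cases
        case 1
        then have "c \<in> fst p ` D" using \<sigma>(1) by (simp add: bij_betw_imp_surj_on)
        then obtain i where i: "i \<in> D" "c = fst p i" by blast
        then have "snd p i \<in> R" using s_cases[OF i(1)] DR[OF i(1)] by auto
        then show ?thesis using merge_t[OF p i(1)] i(2) by (metis imageI)
      next
        case 2
        from s_cases[OF 2(2)] show ?thesis
        proof
          assume "snd p c = Inl c"
          then have "merge p (Inr c) = c" using DR[OF 2(2)] by (simp add: merge_def)
          then show ?thesis using DR(2)[OF 2(2)] by (intro image_eqI[of _ _ "Inr c"]) simp_all
        next
          assume "snd p c = Inr c"
          then have "merge p (Inl c) = c" using DR[OF 2(2)] by (simp add: merge_def)
          then show ?thesis using DR(1)[OF 2(2)] by (intro image_eqI[of _ _ "Inl c"]) simp_all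
        qed
      next
        case 3
        then obtain r where "r \<in> R" "c = base r" by blast
        then have "merge p r = c" using 3(2) by (simp add: merge_def)
        then show ?thesis using \<open>r \<in> R\<close> by blast
      qed
    qed
    ultimately have bij: "bij_betw (merge p) R ?C" by (simp add: bij_betw_def)
    moreover have "merge p \<in> extensional R" by (simp add: merge_def)
    ultimately have "merge p \<in> \<Phi>" by (auto simp: \<Phi>_def PiE_def bij_betw_def)
    moreover have "merge p r \<in> L \<or> merge p r = base r" if "r \<in> R" for r
      using merge_L_iff[OF p that] that by (auto simp: merge_def)
    ultimately show "merge p \<in> \<Phi>0" by (simp add: \<Phi>0_def)
  qed
  also have "\<dots> = (\<Sum>\<sigma>\<in>B. \<Sum>s\<in>S. \<Prod>i\<in>D. A (s i) (\<sigma> i))"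
    by (simp add: sum.cartesian_product case_prod_beta)
  \<comment> \<open>Distributivity read backwards: independent choices of a copy for each
    \<open>i\<close> turn into a product of two-term sums.\<close>
  also have "\<dots> = (\<Sum>\<sigma>\<in>B. \<Prod>i\<in>D. \<Sum>r\<in>{Inl i, Inr i}. A r (\<sigma> i))"
    unfolding S_def by (subst prod_sum_PiE) (use finD in auto)
  also have "\<dots> = permanent D L (\<lambda>i j. A (Inl i) j + A (Inr i) j)"
    by (simp add: permanent_def B_def)
  finally show ?thesis .
qed

lemma card_copies:
  assumes "finite R"
  shows "card R = card (base ` R) + card {i. Inl i \<in> R \<and> Inr i \<in> R}"
proof -
  define X where "X = {i. Inl i \<in> R}"
  define Y where "Y = {i. Inr i \<in> R}"
  have R: "R = X <+> Y" unfolding X_def Y_def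
    by (auto simp: Plus_def) (metis old.sum.exhaust image_eqI mem_Collect_eq)
  have fin: "finite X" "finite Y" using assms R by auto
  have "base ` R = X \<union> Y" unfolding R by (force simp: Plus_def image_Un image_image)
  moreover have "{i. Inl i \<in> R \<and> Inr i \<in> R} = X \<inter> Y" by (auto simp: X_def Y_def)
  moreover have "card R = card X + card Y" unfolding R using fin by (rule card_Plus)
  ultimately show ?thesis using card_Un_Int[OF fin] by simp
qed

section \<open>Submatrices of a symmetrized matrix\<close>

lemma symmetrized_entry:
  assumes "symmetrized I T" "base r \<in> I" "k \<in> I"
  shows "T r k = (if k = base r then Fin 0 else TInfty)"
  using assms by (cases r) (auto simp: symmetrized_def)

lemma exists_unique_optimum_all_base_columns:
  assumes sym: "symmetrized I T" and fin: "finite I" and R: "R \<subseteq> I <+> I"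
    and "C \<subseteq> I \<union> J" "unique_optimum T R C \<sigma>"
  shows "\<exists>C' \<sigma>'. C' \<subseteq> I \<union> J \<and> base ` R \<subseteq> C' \<and> unique_optimum T R C' \<sigma>'"
  using assms(4,5)
proof (induction "card (base ` R - C)" arbitrary: C \<sigma> rule: less_induct)
  case less
  have finR: "finite R" using R fin by (meson finite_Plus finite_subset)
  have baseI: "base ` R \<subseteq> I" using R by auto
  show ?case
  proof (cases "base ` R \<subseteq> C")
    case True
    then show ?thesis using less.prems by blast
  next
    case False
    then obtain k where k: "k \<in> base ` R" "k \<notin> C" by blast
    then have kI: "k \<in> I" using baseI by blast
    have "T r k \<noteq> TInfty \<longleftrightarrow> base r = k" if "r \<in> R" for r
      using symmetrized_entry[OF sym _ kI, of r] baseI that by (auto split: if_splits)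
    then have supp: "{r \<in> R. T r k \<noteq> TInfty} = {r \<in> R. base r = k}" by blast
    also have "\<exists>r1 r2. \<dots> = {r1, r2}"
    proof (cases "Inl k \<in> R \<and> Inr k \<in> R")
      case True
      then have "{r \<in> R. base r = k} = {Inl k, Inr k}" using base_eqD[of _ k] by auto
      then show ?thesis by blast
    next
      case False
      \<comment> \<open>With a single copy of \<open>k\<close> in \<open>R\<close> the two rows
        coincide.\<close>
      obtain r where r: "r \<in> R" "base r = k" using k(1) by blast
      have "x = r" if "x \<in> R" "base x = k" for x
        using that r False by (cases x; cases r) auto
      then have "{r \<in> R. base r = k} = {r, r}" using r by blast
      then show ?thesis by blast
    qed
    finally obtain r1 r2 where r12: "{r \<in> R. T r k \<noteq> TInfty} = {r1, r2}" by blast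
    obtain r where r: "r \<in> {r1, r2}"
      and opt: "unique_optimum T R (insert k (C - {\<sigma> r})) (\<sigma>(r := k))"
      using exchange_column[OF finR less.prems(2) k(2) r12] by blast
    have rR: "r \<in> R" "base r = k" using r r12 supp by auto
    have \<sigma>r: "\<sigma> r \<in> C" "T r (\<sigma> r) \<noteq> TInfty"
      using less.prems(2) rR(1) by (auto simp: unique_optimum_def matching_def bij_betw_apply)
    \<comment> \<open>Within \<open>base\<close>
      R\<open>the only finite entry of row\<close>r\<open>is in column\<close>k\<open>, which\<close>\<sigma>\<open>does not use. So the column given up lies outside\<close>base
      \<open>R\<close>.\<close>
    have "\<sigma> r \<notin> base ` R"
    proof
      assume "\<sigma> r \<in> base ` R"
      then have "\<sigma> r = k"
        using symmetrized_entry[OF sym, of r "\<sigma> r"] \<sigma>r(2) rR(2) kI baseI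
        by (auto split: if_splits)
      then show False using \<sigma>r(1) k(2) by simp
    qed
    moreover have "X - insert k (C - {c}) \<subset> X - C" if "c \<notin> X" "k \<in> X" for X c
      using that k(2) by blast
    ultimately have "base ` R - insert k (C - {\<sigma> r}) \<subset> base ` R - C" using k(1) by blast
    then have "card (base ` R - insert k (C - {\<sigma> r})) < card (base ` R - C)"
      using finR by (intro psubset_card_mono) auto
    moreover have "insert k (C - {\<sigma> r}) \<subseteq> I \<union> J" using less.prems(1) kI by blast
    ultimately show ?thesis using less.hyps opt by blast
  qed
qed

lemma trop_nonsingular_copies_iff:
  assumes sym: "symmetrized I T" and "finite I" "finite J" "I \<inter> J = {}"
    and R: "R \<subseteq> I <+> I" and L: "L \<subseteq> J"
  shows "trop_nonsingular R (base ` R \<union> L) (supertrop_matrix T) \<longleftrightarrow>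
    trop_nonsingular {i. Inl i \<in> R \<and> Inr i \<in> R} L (Sigma_matrix T)"
proof -
  have baseI: "base ` R \<subseteq> I" using R by auto
  have "finite R" "finite L"
    using R L assms(2,3) by (meson finite_Plus finite_subset)+
  moreover have "L \<inter> base ` R = {}" using baseI L assms(4) by blast
  moreover have "supertrop_matrix T r (base r) = 1" if "r \<in> R" for r
    using symmetrized_entry[OF sym, of r "base r"] that baseI
    by (auto simp: supertrop_matrix_def one_supertrop_def)
  moreover have "supertrop_matrix T r i = 0" if "r \<in> R" "i \<in> base ` R" "i \<noteq> base r" for r i
  proof -
    have "base r \<in> I" "i \<in> I" using that baseI by auto
    then show ?thesis
      using symmetrized_entry[OF sym, of r i] that(3)
      by (simp add: supertrop_matrix_def zero_supertrop_def)
  qed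
  ultimately have "permanent R (base ` R \<union> L) (supertrop_matrix T) =
    permanent {i. Inl i \<in> R \<and> Inr i \<in> R} L
      (\<lambda>i j. supertrop_matrix T (Inl i) j + supertrop_matrix T (Inr i) j)"
    by (intro permanent_copies refl) auto
  then show ?thesis
    by (simp add: trop_nonsingular_def Sigma_matrix_def supertrop_matrix_def)
qed

section \<open>Comparison of the two ranks\<close>

lemma tropical_rank_ge:
  assumes "finite Rows" "R \<subseteq> Rows" "C \<subseteq> Cols" "card C = card R" "trop_nonsingular R C A"
  shows "card R \<le> tropical_rank Rows Cols A"
proof -
  have "finite {m. \<exists>R C. R \<subseteq> Rows \<and> C \<subseteq> Cols \<and> card R = m \<and> card C = m \<and> trop_nonsingular R C A}"
    by (rule finite_subset[of _ "{..card Rows}"]) (auto simp: card_mono assms(1))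
  then show ?thesis
    unfolding tropical_rank_def by (rule Max_ge) (use assms in auto)
qed

lemma tropical_rank_witness:
  fixes A :: "'r \<Rightarrow> 'c \<Rightarrow> supertrop"
  assumes "finite Rows"
  obtains R C where "R \<subseteq> Rows" "C \<subseteq> Cols" "card R = tropical_rank Rows Cols A"
    "card C = card R" "trop_nonsingular R C A"
proof -
  let ?M = "{m. \<exists>R C. R \<subseteq> Rows \<and> C \<subseteq> Cols \<and> card R = m \<and> card C = m \<and> trop_nonsingular R C A}"
  have "finite ?M"
    by (rule finite_subset[of _ "{..card Rows}"]) (auto simp: card_mono assms)
  moreover have "trop_nonsingular {} {} A"
  proof -
    have "permanent {} {} A = (\<Sum>\<sigma>\<in>{\<lambda>x :: 'r. undefined :: 'c}. 1)"
      unfolding permanent_def by (rule sum.cong) (auto simp: bij_betw_def)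
    then have "permanent {} {} A = 1" by simp
    then show ?thesis by (simp add: trop_nonsingular_def tangible_def one_supertrop_def)
  qed
  then have "0 \<in> ?M" by (auto intro!: exI[of _ "{}"])
  ultimately have "Max ?M \<in> ?M" by (intro Max_in) auto
  then show thesis using that unfolding tropical_rank_def by auto
qed

theorem theorem4:
  fixes I J :: "'a set" and T :: "'a + 'a \<Rightarrow> 'a \<Rightarrow> trop"
  assumes "finite I" and "finite J" and "I \<inter> J = {}"
    and "symmetrized I T"
  shows "tropical_rank (I <+> I) (I \<union> J) (supertrop_matrix T) =
         tropical_rank I J (Sigma_matrix T) + card I"
proof (rule antisym)
  have finII: "finite (I <+> I)" using assms(1) by simp
  show "tropical_rank (I <+> I) (I \<union> J) (supertrop_matrix T) \<le>
      tropical_rank I J (Sigma_matrix T) + card I"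
  proof -
    obtain R C where R: "R \<subseteq> I <+> I" and C: "C \<subseteq> I \<union> J"
      and card_R: "card R = tropical_rank (I <+> I) (I \<union> J) (supertrop_matrix T)"
      and ns: "trop_nonsingular R C (supertrop_matrix T)"
      using tropical_rank_witness[OF finII] by metis
    have finR: "finite R" using R finII finite_subset by blast
    have fin_cols: "finite C'" if "C' \<subseteq> I \<union> J" for C'
      using that assms(1,2) by (meson finite_UnI finite_subset)
    obtain \<tau> where "unique_optimum T R C \<tau>"
      using ns trop_nonsingular_iff_unique_optimum[OF finR fin_cols[OF C]] by auto
    then obtain \<sigma> C' where C': "C' \<subseteq> I \<union> J" "base ` R \<subseteq> C'" and \<sigma>: "unique_optimum T R C' \<sigma>"
      using exists_unique_optimum_all_base_columns[OF assms(4,1) R C] by metis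
    have bij: "bij_betw \<sigma> R C'" and fin: "\<And>r. r \<in> R \<Longrightarrow> T r (\<sigma> r) \<noteq> TInfty"
      using \<sigma> by (auto simp: unique_optimum_def matching_def)
    have "c \<in> base ` R" if "c \<in> C'" "c \<in> I" for c
    proof -
      have "c \<in> \<sigma> ` R" using bij that(1) by (simp add: bij_betw_imp_surj_on)
      then obtain r where r: "r \<in> R" "c = \<sigma> r" by blast
      moreover have "base r \<in> I" using R r(1) by auto
      ultimately have "c = base r"
        using symmetrized_entry[OF assms(4), of r c] that(2) fin[OF r(1)] by (auto split: if_splits)
      then show ?thesis using r(1) by blast
    qed
    moreover define L where "L = C' \<inter> J"
    ultimately have C'_eq: "C' = base ` R \<union> L" using C' by blast
    have baseI: "base ` R \<subseteq> I" using R by auto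
    define D where "D = {i. Inl i \<in> R \<and> Inr i \<in> R}"
    have "trop_nonsingular R C' (supertrop_matrix T)"
      unfolding trop_nonsingular_iff_unique_optimum[OF finR fin_cols[OF C'(1)]] using \<sigma> by (rule exI[of _ \<sigma>])
    moreover have LJ: "L \<subseteq> J" by (simp add: L_def)
    ultimately have ns_D: "trop_nonsingular D L (Sigma_matrix T)"
      using trop_nonsingular_copies_iff[OF assms(4,1-3) R LJ]
      unfolding C'_eq[symmetric] D_def[symmetric] by simp
    have card_D: "card R = card (base ` R) + card D"
      using card_copies[OF finR] by (simp add: D_def)
    moreover have "card C' = card (base ` R) + card L"
      unfolding C'_eq
      by (rule card_Un_disjoint) (use finR baseI assms(2,3) in \<open>auto simp: L_def\<close>)
    moreover have "card C' = card R" using bij by (simp add: bij_betw_same_card)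
    ultimately have "card L = card D" by simp
    then have "card D \<le> tropical_rank I J (Sigma_matrix T)"
      using tropical_rank_ge[OF assms(1) _ LJ _ ns_D] R by (auto simp: D_def)
    moreover have "card (base ` R) \<le> card I" using baseI assms(1) by (rule card_mono[rotated])
    ultimately show ?thesis using card_D card_R by simp
  qed
  show "tropical_rank I J (Sigma_matrix T) + card I \<le>
      tropical_rank (I <+> I) (I \<union> J) (supertrop_matrix T)"
  proof -
    obtain D L where D: "D \<subseteq> I" and L: "L \<subseteq> J"
      and card_D: "card D = tropical_rank I J (Sigma_matrix T)" "card L = card D"
      and ns: "trop_nonsingular D L (Sigma_matrix T)"
      using tropical_rank_witness[OF assms(1)] by metis
    have fin: "finite D" "finite L" using D L assms(1,2) by (auto intro: finite_subset)
    \<comment> \<open>All first copies together with the second copies of \<open>D\<close>: every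
      column of \<open>I\<close> is a base column, and exactly the rows of \<open>D\<close> are
      doubled.\<close>
    define R where "R = I <+> D"
    have R: "R \<subseteq> I <+> I" using D by (auto simp: R_def)
    have base_R: "base ` R = I" using D by (force simp: R_def Plus_def image_Un image_image)
    have D_eq: "{i. Inl i \<in> R \<and> Inr i \<in> R} = D" using D by (auto simp: R_def)
    have "trop_nonsingular R (I \<union> L) (supertrop_matrix T)"
      using trop_nonsingular_copies_iff[OF assms(4,1-3) R L] ns by (simp add: base_R D_eq)
    moreover have card_R: "card R = card I + card D"
      unfolding R_def using assms(1) fin(1) by (rule card_Plus)
    moreover have "card (I \<union> L) = card I + card L"
      by (rule card_Un_disjoint) (use assms(1,3) fin(2) L in auto)
    ultimately have "card R \<le> tropical_rank (I <+> I) (I \<union> J) (supertrop_matrix T)"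
      using tropical_rank_ge[OF finII R, of "I \<union> L" "I \<union> J" "supertrop_matrix T"] L card_D(2) by auto
    then show ?thesis using card_R card_D(1) by simp
  qed
qed

end
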